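(* Let $\alpha\ge-\frac12$. For all $x,y\in\mathbb{R}_q$, $$\int_{-\infty}^{+\infty}\psi_\lambda^{\alpha,q}(x)\,\overline{\psi_\lambda^{\alpha,q}(y)}\,|\lambda|^{2\alpha+1}\,d_q\lambda=\frac{4(1+q)^{2\alpha}\,\Gamma_{q^2}^2(\alpha+1)\,\delta_{x,y}}{(1-q)\,|xy|^{\alpha+1}},$$ where $\delta_{x,y}$ is the Kronecker symbol.
   Context: Standing assumptions: $q\in(0,1)$ and $\frac{\log(1-q)}{\log q}\in 2\mathbb{Z}$. $\mathbb{R}_q=\{\pm q^n: n\in\mathbb{Z}\}$. Notation: $(a;q)_\infty=\prod_{k\ge0}(1-aq^k)$, $[x]_q=\frac{1-q^x}{1-q}$, $\Gamma_{q^2}(x)=\frac{(q^2;q^2)_\infty}{(q^{2x};q^2)_\infty}(1-q^2)^{1-x}$. $q$-Jackson integral: $\int_{-\infty}^{\infty}f(x)\,d_qx=(1-q)\sum_{n=-\infty}^{\infty}q^n[f(q^n)+f(-q^n)]$. Normalized $q$-Bessel function: $j_\alpha(x;q^2)=\sum_{n\ge0}(-1)^n\frac{\Gamma_{q^2}(\alpha+1)q^{n(n+1)}}{\Gamma_{q^2}(\alpha+n+1)\Gamma_{q^2}(n+1)}\left(\frac{x}{1+q}\right)^{2n}$. $q$-Dunkl kernel: $\psi_\lambda^{\alpha,q}(x)=j_\alpha(\lambda x;q^2)+\frac{i\lambda x}{[2\alpha+2]_q}j_{\alpha+1}(\lambda x;q^2)$. The bar denotes complex conjugation. *)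

theory Defs
  imports "HOL-Analysis.Analysis"
begin

definition qpoch_inf :: "real \<Rightarrow> real \<Rightarrow> real" where
  "qpoch_inf a p = (\<Prod>k. 1 - a * p ^ k)"

definition q_bracket :: "real \<Rightarrow> real \<Rightarrow> real" where
  "q_bracket q x = (1 - q powr x) / (1 - q)"

text \<open>\<open>\<Gamma>\<^sub>p(x)\<close> for a general base \<open>p\<close>; it is used below with \<open>p = q\<^sup>2\<close>,
  where \<open>p powr x\<close> is \<open>q\<close> to the power \<open>2x\<close>.\<close>

definition q_Gamma :: "real \<Rightarrow> real \<Rightarrow> real" where
  "q_Gamma p x = qpoch_inf p p / qpoch_inf (p powr x) p * (1 - p) powr (1 - x)"

definition R_q :: "real \<Rightarrow> real set" where
  "R_q q = {x. \<exists>n::int. x = q powi n \<or> x = - (q powi n)}"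

text \<open>The Jackson integral over the whole real line. The two-sided series is read as an
  unconditionally convergent sum over the integers; as \<^const>\<open>infsum\<close> is \<open>0\<close> for
  families that are not summable, convergence is a separate predicate.\<close>

definition jackson_summand :: "real \<Rightarrow> (real \<Rightarrow> complex) \<Rightarrow> int \<Rightarrow> complex" where
  "jackson_summand q f n = of_real (q powi n) * (f (q powi n) + f (- (q powi n)))"

definition jackson_integrable :: "real \<Rightarrow> (real \<Rightarrow> complex) \<Rightarrow> bool" where
  "jackson_integrable q f \<longleftrightarrow> jackson_summand q f summable_on UNIV"

definition jackson_integral :: "real \<Rightarrow> (real \<Rightarrow> complex) \<Rightarrow> complex" where
  "jackson_integral q f = of_real (1 - q) * (\<Sum>\<^sub>\<infinity>n. jackson_summand q f n)"

text \<open>\<open>j\<^sub>\<alpha>(x; q\<^sup>2)\<close>: the parameter here is \<open>q\<close>, not its square.\<close>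

definition q_bessel :: "real \<Rightarrow> real \<Rightarrow> real \<Rightarrow> real" where
  "q_bessel q \<alpha> x =
     (\<Sum>n::nat. (- 1) ^ n
        * (q_Gamma (q^2) (\<alpha> + 1) * q ^ (n * (n + 1))
           / (q_Gamma (q^2) (\<alpha> + real n + 1) * q_Gamma (q^2) (real n + 1)))
        * (x / (1 + q)) ^ (2 * n))"

text \<open>Argument order: \<open>l\<close> is the spectral parameter (the subscript of \<open>\<psi>\<close>), \<open>x\<close> the point.\<close>

definition q_dunkl_kernel :: "real \<Rightarrow> real \<Rightarrow> real \<Rightarrow> real \<Rightarrow> complex" where
  "q_dunkl_kernel q \<alpha> l x =
     of_real (q_bessel q \<alpha> (l * x))
     + \<i> * of_real (l * x) / of_real (q_bracket q (2 * \<alpha> + 2))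
         * of_real (q_bessel q (\<alpha> + 1) (l * x))"

end

theory Submission
  imports Defs
begin

text \<open>With \<open>p = q\<^sup>2\<close> and \<open>c = p\<^bsup>\<alpha>+1\<^esup>\<close>, the function \<open>j\<^sub>\<alpha>\<close> is, up to a constant, a Hahn--Exton
  \<open>q\<close>-Bessel function. Its values on the lattice are the coefficients \<open>F\<^sub>k\<close> of the Laurent
  series of \<open>G(s) = (c/s; p)\<^sub>\<infinity> / (s; p)\<^sub>\<infinity>\<close> on \<open>0 < |s| < 1\<close>; here the assumption on \<open>q\<close> is used,
  as \<open>1 - q\<close> has to be an integral power of \<open>q\<close>. Since \<open>G(s) G(c/s) = 1\<close> on \<open>c < |s| < 1\<close>,
  comparing coefficients gives \<open>\<Sum>\<^sub>k c\<^sup>k F\<^sub>k F\<^bsub>k+d\<^esub> = \<delta>\<^bsub>d,0\<^esub>\<close>. In the integral, the terms for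
  \<open>\<lambda>\<close> and \<open>-\<lambda>\<close> cancel the mixed products of \<open>j\<^sub>\<alpha>\<close> and \<open>j\<^bsub>\<alpha>+1\<^esub>\<close>, and the two remaining
  orthogonality relations have the same constant, up to the sign of \<open>xy\<close>: they add up for
  \<open>x = y\<close> and cancel for \<open>x = -y\<close>.\<close>

text \<open>The coefficients in Euler's expansions
  \<open>(s; p)\<^sub>\<infinity> = \<Sum>\<^sub>n euler_coeff p n \<cdot> s\<^sup>n\<close> and \<open>1 / (s; p)\<^sub>\<infinity> = \<Sum>\<^sub>n inv_qpoch p n \<cdot> s\<^sup>n\<close>.\<close>

primrec euler_coeff :: "real \<Rightarrow> nat \<Rightarrow> real" where
  "euler_coeff p 0 = 1"
| "euler_coeff p (Suc n) = - (p ^ n / (1 - p ^ Suc n)) * euler_coeff p n"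

primrec inv_qpoch :: "real \<Rightarrow> nat \<Rightarrow> real" where
  "inv_qpoch p 0 = 1"
| "inv_qpoch p (Suc n) = inv_qpoch p n / (1 - p ^ Suc n)"

text \<open>For 0 < p < 1 this is (a; p)_\<infinity>, an entire function of \<open>a\<close>. The
  series form also serves at the points \<open>p powi k\<close> with k \<le> 0, where the function
  vanishes.\<close>

definition euler_sum :: "real \<Rightarrow> real \<Rightarrow> real" where
  "euler_sum p a = (\<Sum>n. euler_coeff p n * a ^ n)"

text \<open>Power series coefficients become Laurent coefficients, so that index shifts and changes
  of variable run over all integers without range conditions.\<close>

definition zero_extend :: "(nat \<Rightarrow> real) \<Rightarrow> int \<Rightarrow> real" where
  "zero_extend f k = (if k < 0 then 0 else f (nat k))"

text \<open>The Laurent coefficient \<open>F\<^sub>k\<close> of \<open>(c/s; p)\<^sub>\<infinity> / (s; p)\<^sub>\<infinity>\<close>.\<close>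

definition hahn_exton :: "real \<Rightarrow> real \<Rightarrow> int \<Rightarrow> real" where
  "hahn_exton p c k = (\<Sum>n. euler_coeff p n * c ^ n * zero_extend (inv_qpoch p) (k + int n))"

section \<open>Unconditional sums over the integers and over product sets\<close>

lemma has_sum_zero_extend:
  "(zero_extend f has_sum s) UNIV \<longleftrightarrow> (f has_sum s) UNIV"
proof -
  have "(zero_extend f has_sum s) UNIV \<longleftrightarrow> (zero_extend f has_sum s) (range int)"
    by (rule has_sum_cong_neutral)
      (auto simp: zero_extend_def image_iff, metis nonneg_int_cases not_less)
  also have "\<dots> \<longleftrightarrow> (zero_extend f \<circ> int has_sum s) UNIV"
    by (rule has_sum_reindex) auto
  also have "zero_extend f \<circ> int = f"
    by (auto simp: zero_extend_def)
  finally show ?thesis .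
qed

lemma summable_on_Times_nonneg:
  fixes f :: "'a \<Rightarrow> real" and g :: "'b \<Rightarrow> real"
  assumes "f summable_on A" "g summable_on B"
    and "\<And>x. x \<in> A \<Longrightarrow> 0 \<le> f x" "\<And>y. y \<in> B \<Longrightarrow> 0 \<le> g y"
  shows "(\<lambda>(x, y). f x * g y) summable_on A \<times> B"
proof (rule summable_on_SigmaI)
  fix x
  show "((\<lambda>y. case (x, y) of (x, y) \<Rightarrow> f x * g y) has_sum f x * infsum g B) B"
    using has_sum_cmult_right[OF has_sum_infsum[OF assms(2)], of "f x"] by simp
next
  show "(\<lambda>x. f x * infsum g B) summable_on A"
    using assms(1) by (rule summable_on_cmult_left)
qed (use assms in auto)

section \<open>Euler's expansions of the infinite q-shifted factorial in a base p\<close>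

locale q_base =
  fixes p :: real
  assumes p: "0 < p" "p < 1"
begin

abbreviation "e \<equiv> euler_coeff p"
abbreviation "g \<equiv> inv_qpoch p"
abbreviation "E \<equiv> euler_sum p"
abbreviation "gz \<equiv> zero_extend (inv_qpoch p)"
abbreviation "ez \<equiv> zero_extend (euler_coeff p)"

lemma pow_Suc_less: "p ^ Suc n < 1"
  using p power_Suc_less_one[of p n] by simp

lemma pow_Suc_nz: "1 - p ^ Suc n \<noteq> 0" "1 - p * p ^ n \<noteq> 0"
  using pow_Suc_less[of n] by auto

text \<open>Coefficient form of (s; p)_\<infinity> times 1 / (s; p)_\<infinity> = 1. The sums
  satisfy a first-order recurrence in n, whose factor 1 - p^0 = 0 makes every term after the first
  vanish.\<close>

lemma convolution: "(\<Sum>i\<le>n. e i * g (n - i)) = (if n = 0 then 1 else 0)"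
proof -
  define h where "h n = (\<Sum>i\<le>n. e i * g (n - i))" for n
  have rec: "(1 - p ^ Suc n) * h (Suc n) = (1 - p ^ n) * h n" for n
  proof -
    \<comment> \<open>Splitting 1 - p^(n+1) as (1 - p^(n+1-i)) + p^(n+1-i) (1 - p^i) lets each part
      cancel the denominator in one of the two coefficient recursions.\<close>
    have eq: "(1 - p ^ Suc n) * (e i * g (Suc n - i)) =
        e i * ((1 - p ^ (Suc n - i)) * g (Suc n - i))
        + p ^ (Suc n - i) * ((1 - p ^ i) * e i) * g (Suc n - i)" if "i \<le> Suc n" for i
    proof -
      have "p ^ Suc n = p ^ (Suc n - i) * p ^ i"
        using that by (metis le_add_diff_inverse2 power_add)
      then show ?thesis by (simp add: algebra_simps)
    qed
    have "(1 - p ^ Suc n) * h (Suc n) =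
        (\<Sum>i\<le>Suc n. e i * ((1 - p ^ (Suc n - i)) * g (Suc n - i)))
        + (\<Sum>i\<le>Suc n. p ^ (Suc n - i) * ((1 - p ^ i) * e i) * g (Suc n - i))"
      unfolding h_def sum_distrib_left sum.distrib[symmetric]
      by (intro sum.cong refl eq) auto
    also have "(\<Sum>i\<le>Suc n. e i * ((1 - p ^ (Suc n - i)) * g (Suc n - i))) = h n"
    proof -
      have "(1 - p ^ (Suc n - i)) * g (Suc n - i) = g (n - i)" if "i \<le> n" for i
        using that pow_Suc_nz[of "n - i"] by (simp add: Suc_diff_le)
      then show ?thesis by (simp add: h_def)
    qed
    also have "(\<Sum>i\<le>Suc n. p ^ (Suc n - i) * ((1 - p ^ i) * e i) * g (Suc n - i))
        = - (p ^ n * h n)"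
    proof -
      have "p ^ (n - i) * ((1 - p ^ Suc i) * e (Suc i)) * g (n - i) = - (p ^ n * (e i * g (n - i)))"
        if "i \<le> n" for i
      proof -
        have "p ^ n = p ^ (n - i) * p ^ i"
          using that by (metis le_add_diff_inverse2 power_add)
        then show ?thesis using pow_Suc_nz[of i] by simp
      qed
      then show ?thesis
        by (simp add: sum.atMost_Suc_shift h_def sum_distrib_left sum_negf del: sum.atMost_Suc power_Suc euler_coeff.simps(2))
    qed
    finally show ?thesis by (simp add: algebra_simps)
  qed
  have "h (Suc n) = 0" for n
  proof (induction n)
    case 0
    then show ?case using rec[of 0] p by simp
  next
    case (Suc n)
    then show ?case using rec[of "Suc n"] pow_Suc_nz(1)[of "Suc n"] by (simp del: power_Suc)
  qed
  moreover have "h 0 = 1" by (simp add: h_def)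
  ultimately have "h n = (if n = 0 then 1 else 0)" by (cases n) auto
  then show ?thesis by (simp add: h_def)
qed

lemma summable_abs_euler: "summable (\<lambda>n. \<bar>e n * a ^ n\<bar>)"
proof -
  have "(\<lambda>n. p ^ n * (\<bar>a\<bar> / (1 - p))) \<longlonglongrightarrow> 0 * (\<bar>a\<bar> / (1 - p))"
    using p by (intro tendsto_intros LIMSEQ_realpow_zero) auto
  then have "eventually (\<lambda>n. p ^ n * (\<bar>a\<bar> / (1 - p)) < 1 / 2) sequentially"
    by (intro order_tendstoD(2)) auto
  then obtain N where N: "p ^ n * (\<bar>a\<bar> / (1 - p)) < 1 / 2" if "n \<ge> N" for n
    by (auto simp: eventually_sequentially)
  show ?thesis
  proof (rule summable_ratio_test[where c = "1 / 2" and N = N])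
    fix n assume "n \<ge> N"
    have "p ^ Suc n \<le> p"
      using p power_decreasing[of 1 "Suc n" p] by simp
    then have "p ^ n / (1 - p ^ Suc n) \<le> p ^ n / (1 - p)"
      using p pow_Suc_less[of n] by (intro divide_left_mono mult_pos_pos) auto
    then have "p ^ n / (1 - p ^ Suc n) * \<bar>a\<bar> \<le> p ^ n / (1 - p) * \<bar>a\<bar>"
      by (intro mult_right_mono) auto
    also have "\<dots> \<le> 1 / 2" using N[OF \<open>n \<ge> N\<close>] by simp
    finally have le: "p ^ n / (1 - p ^ Suc n) * \<bar>a\<bar> \<le> 1 / 2" .
    have "\<bar>e (Suc n) * a ^ Suc n\<bar> = (p ^ n / (1 - p ^ Suc n) * \<bar>a\<bar>) * \<bar>e n * a ^ n\<bar>"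
      using p pow_Suc_less[of n] by (simp add: abs_mult)
    also have "\<dots> \<le> 1 / 2 * \<bar>e n * a ^ n\<bar>"
      using le by (rule mult_right_mono) simp
    finally show "norm \<bar>e (Suc n) * a ^ Suc n\<bar> \<le> 1 / 2 * norm \<bar>e n * a ^ n\<bar>"
      by simp
  qed simp
qed

lemma summable_euler: "summable (\<lambda>n. e n * a ^ n)"
  using summable_rabs_cancel[OF summable_abs_euler] .

lemma euler_sums: "(\<lambda>n. e n * a ^ n) sums E a"
  using summable_sums[OF summable_euler] by (simp add: euler_sum_def)

lemma euler_has_sum: "((\<lambda>n. e n * a ^ n) has_sum E a) UNIV"
  using norm_summable_imp_has_sum[OF _ euler_sums] summable_abs_euler by simp

lemma euler_zero: "E 0 = 1"
  using powser_sums_zero[of e] euler_sums[of 0] by (simp add: sums_unique2)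

text \<open>Functional equation of (a; p)_\<infinity>, read off from the coefficient recursion (1 -
  p^(n+1)) e_(n+1) = - p^n e_n.\<close>

lemma euler_rec: "E a = (1 - a) * E (p * a)"
proof -
  have 1: "(\<lambda>n. e n * a ^ n - e n * (p * a) ^ n) sums (E a - E (p * a))"
    by (intro sums_diff euler_sums)
  have "(\<lambda>n. e (Suc n) * a ^ Suc n - e (Suc n) * (p * a) ^ Suc n) sums (E a - E (p * a))"
    using sums_Suc_iff[of "\<lambda>n. e n * a ^ n - e n * (p * a) ^ n" "E a - E (p * a)"] 1 by simp
  moreover have "e (Suc n) * a ^ Suc n - e (Suc n) * (p * a) ^ Suc n = - a * (e n * (p * a) ^ n)" for n
  proof -
    have "e (Suc n) * a ^ Suc n - e (Suc n) * (p * a) ^ Suc n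
        = ((1 - p ^ Suc n) * e (Suc n)) * a ^ Suc n"
      by (simp add: power_mult_distrib algebra_simps del: euler_coeff.simps(2))
    also have "(1 - p ^ Suc n) * e (Suc n) = - (p ^ n * e n)"
      using pow_Suc_nz[of n] by simp
    finally show ?thesis by (simp add: power_mult_distrib)
  qed
  ultimately have "(\<lambda>n. - a * (e n * (p * a) ^ n)) sums (E a - E (p * a))"
    by simp
  moreover have "(\<lambda>n. - a * (e n * (p * a) ^ n)) sums (- a * E (p * a))"
    by (intro sums_mult euler_sums)
  ultimately have "E a - E (p * a) = - a * E (p * a)"
    by (rule sums_unique2)
  then show ?thesis by (simp add: algebra_simps)
qed

lemma euler_prod: "E a = (\<Prod>k<n. 1 - a * p ^ k) * E (a * p ^ n)"
proof (induction n)
  case (Suc n)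
  then show ?case using euler_rec[of "a * p ^ n"] by (simp add: mult_ac)
qed simp

lemma euler_lim: "(\<lambda>n. E (a * p ^ n)) \<longlonglongrightarrow> 1"
proof -
  have "isCont E 0"
    unfolding euler_sum_def[abs_def]
    by (rule isCont_powser[where K = 1]) (use summable_euler[of 1] in auto)
  moreover have "(\<lambda>n. a * p ^ n) \<longlonglongrightarrow> a * 0"
    using p by (intro tendsto_intros LIMSEQ_realpow_zero) auto
  ultimately show ?thesis
    using isCont_tendsto_compose[of 0 E] by (simp add: euler_zero)
qed

lemma euler_pos:
  assumes "0 < a" "a < 1"
  shows "E a > 0"
proof -
  have "eventually (\<lambda>n. E (a * p ^ n) > 0) sequentially"
    using order_tendstoD(1)[OF euler_lim] by simp
  then obtain n where "E (a * p ^ n) > 0"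
    by (auto simp: eventually_sequentially)
  moreover have "a * p ^ k < 1" for k
  proof -
    have "a * p ^ k \<le> a * 1"
      using p assms by (intro mult_left_mono power_le_one) auto
    then show ?thesis using assms by linarith
  qed
  then have "(\<Prod>k<n. 1 - a * p ^ k) > 0"
    by (intro prod_pos) simp
  ultimately show ?thesis
    using euler_prod[of a n] by simp
qed

text \<open>Iterating the functional equation splits off the partial products, and the remaining
  factor \<open>E (a * p ^ n)\<close> tends to E(0) = 1 by continuity. Positivity supplies the
  nonzero limit by which the infinite product is identified.\<close>

lemma qpoch_inf_eq_euler:
  assumes "0 < a" "a < 1"
  shows "qpoch_inf a p = E a"
  unfolding qpoch_inf_def
proof (rule prodinf_eq_prod_lim')
  have ev: "eventually (\<lambda>n. E (a * p ^ n) > 0) sequentially"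
    using order_tendstoD(1)[OF euler_lim] by simp
  have "(\<lambda>n. E a / E (a * p ^ n)) \<longlonglongrightarrow> E a / 1"
    by (intro tendsto_intros euler_lim) simp
  moreover have "eventually (\<lambda>n. E a / E (a * p ^ n) = (\<Prod>k<n. 1 - a * p ^ k)) sequentially"
    using ev
  proof eventually_elim
    case (elim n)
    then show ?case using euler_prod[of a n] by simp
  qed
  ultimately show "(\<lambda>n. \<Prod>k<n. 1 - a * p ^ k) \<longlonglongrightarrow> E a"
    by (simp add: tendsto_cong)
  show "E a \<noteq> 0"
    using euler_pos[OF assms] by simp
qed

lemma euler_pow_Suc: "E (p ^ Suc n) = E p * g n"
proof (induction n)
  case (Suc n)
  then show ?case
    using euler_rec[of "p ^ Suc n"] pow_Suc_nz[of n] by (simp add: field_simps)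
qed simp

text \<open>The zeros of (s; p)_\<infinity> at s = p^(-n), n \<ge> 0, match the vanishing of
  \<open>gz\<close> at negative indices. This is what turns values on the lattice into Laurent
  coefficients.\<close>

lemma euler_powi: "E (p powi (k + 1)) = E p * gz k"
proof (cases "k < 0")
  case False
  then show ?thesis
    using euler_pow_Suc[of "nat k"]
    by (simp add: zero_extend_def power_int_def nat_add_distrib)
next
  case True
  have "E (p powi (- int n)) = 0" for n
  proof (induction n)
    \<comment> \<open>The factor 1 - a of the functional equation vanishes at a = 1, and the
      equation carries this zero on to p^(-1), p^(-2), and so on.\<close>
    case 0
    then show ?case using euler_rec[of 1] by simp
  next
    case (Suc n)
    have "p * p powi (- int (Suc n)) = p powi (1 + - int (Suc n))"
      using p by (subst power_int_add) auto
    then show ?case using Suc euler_rec[of "p powi (- int (Suc n))"] by simp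
  qed
  from this[of "nat (- (k + 1))"] show ?thesis
    using True by (simp add: zero_extend_def add.commute)
qed

section \<open>Bounds uniform in the index\<close>

lemma inv_qpoch_pos: "g n > 0"
  by (induction n) (use pow_Suc_less in simp_all)

definition abs_coeff_sum where "abs_coeff_sum = (\<Sum>n. \<bar>e n\<bar>)"

lemma summable_abs_coeff: "summable (\<lambda>n. \<bar>e n\<bar>)"
  using summable_abs_euler[of 1] by simp

lemma abs_euler_le:
  assumes "\<bar>a\<bar> \<le> 1"
  shows "\<bar>E a\<bar> \<le> abs_coeff_sum"
proof -
  have "\<bar>E a\<bar> \<le> (\<Sum>n. \<bar>e n * a ^ n\<bar>)"
    unfolding euler_sum_def by (rule summable_rabs[OF summable_abs_euler])
  also have "\<dots> \<le> abs_coeff_sum"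
    unfolding abs_coeff_sum_def
  proof (rule suminf_le[OF _ summable_abs_euler summable_abs_coeff])
    fix n
    have "\<bar>a\<bar> ^ n \<le> 1" using assms by (simp add: power_le_one)
    then show "\<bar>e n * a ^ n\<bar> \<le> \<bar>e n\<bar>"
      by (simp add: abs_mult power_abs mult_left_le)
  qed
  finally show ?thesis .
qed

text \<open>Comes from g_n = E(p^(n+1)) / E(p), where |E| is at most \<open>abs_coeff_sum\<close> on
  [-1, 1].\<close>

definition inv_qpoch_bound where "inv_qpoch_bound = abs_coeff_sum / E p"

lemma inv_qpoch_ext_bounds: "0 \<le> gz k" "gz k \<le> inv_qpoch_bound"
proof -
  show nn: "0 \<le> gz k"
    using inv_qpoch_pos less_imp_le by (auto simp: zero_extend_def)
  have A: "abs_coeff_sum \<ge> 0" using abs_euler_le[of 0] by simp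
  have Ep: "E p > 0" using euler_pos p by auto
  show "gz k \<le> inv_qpoch_bound"
  proof (cases "k < 0")
    case True
    then show ?thesis using A Ep by (simp add: zero_extend_def inv_qpoch_bound_def)
  next
    case False
    have "p ^ Suc (nat k) \<le> 1" using pow_Suc_less[of "nat k"] by (rule less_imp_le)
    moreover have "0 < p ^ Suc (nat k)" using p by simp
    ultimately have "\<bar>E (p ^ Suc (nat k))\<bar> \<le> abs_coeff_sum"
      by (intro abs_euler_le) simp
    then have "E p * gz k \<le> abs_coeff_sum"
      using False by (auto simp: euler_pow_Suc zero_extend_def simp del: power_Suc)
    then show ?thesis using Ep by (simp add: inv_qpoch_bound_def field_simps)
  qed
qed

section \<open>The Bessel series at lattice points\<close>

lemma hahn_exton_has_sum:
  "((\<lambda>n. e n * c ^ n * gz (k + int n)) has_sum hahn_exton p c k) UNIV"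
proof -
  have "summable (\<lambda>n. norm (e n * c ^ n * gz (k + int n)))"
  proof (rule summable_comparison_test')
    show "summable (\<lambda>n. \<bar>e n * c ^ n\<bar> * inv_qpoch_bound)"
      by (intro summable_mult2 summable_abs_euler)
    show "norm (norm (e n * c ^ n * gz (k + int n))) \<le> \<bar>e n * c ^ n\<bar> * inv_qpoch_bound" for n
      using inv_qpoch_ext_bounds[of "k + int n"] by (simp add: abs_mult mult_left_mono)
  qed
  then show ?thesis
    unfolding hahn_exton_def
    by (intro norm_summable_imp_has_sum summable_sums) (auto intro: summable_norm_cancel)
qed

text \<open>Expanding \<open>(c p\<^sup>n; p)\<^sub>\<infinity>\<close> by Euler's formula gives a double series which is
  symmetric in \<open>z\<close> and \<open>c\<close>.\<close>

lemma euler_double_sum_symmetric: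
  assumes z: "z > 0" and c: "0 < c" "c < 1"
  shows "((\<lambda>n. e n * z ^ n * E (c * p ^ n)) has_sum s) UNIV \<longleftrightarrow>
         ((\<lambda>m. e m * c ^ m * E (z * p ^ m)) has_sum s) UNIV"
proof -
  define T where "T n m = e n * z ^ n * (e m * (c * p ^ n) ^ m)" for n m
  have T': "T n m = e m * c ^ m * (e n * (z * p ^ m) ^ n)" for n m
    by (simp add: T_def power_mult_distrib mult_ac flip: power_mult)
  have "(\<lambda>(n, m). \<bar>e n * z ^ n\<bar> * \<bar>e m * c ^ m\<bar>) summable_on UNIV \<times> UNIV"
    by (intro summable_on_Times_nonneg norm_summable_imp_summable_on) (use summable_abs_euler in auto)
  then have "(\<lambda>x. norm (case x of (n, m) \<Rightarrow> T n m)) summable_on UNIV \<times> UNIV"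
  proof (rule Infinite_Sum.abs_summable_on_comparison_test')
    fix x :: "nat \<times> nat"
    obtain n m where x: "x = (n, m)" by (cases x)
    have "p ^ (n * m) \<le> 1" using p by (intro power_le_one) auto
    then have "\<bar>e n * z ^ n\<bar> * \<bar>e m * c ^ m\<bar> * p ^ (n * m) \<le> \<bar>e n * z ^ n\<bar> * \<bar>e m * c ^ m\<bar>"
      using p by (intro mult_left_le) auto
    moreover have "\<bar>T n m\<bar> = \<bar>e n * z ^ n\<bar> * \<bar>e m * c ^ m\<bar> * p ^ (n * m)"
      using p by (simp add: T_def abs_mult power_mult_distrib power_mult)
    ultimately show "norm (case x of (n, m) \<Rightarrow> T n m) \<le> (case x of (n, m) \<Rightarrow> \<bar>e n * z ^ n\<bar> * \<bar>e m * c ^ m\<bar>)"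
      by (simp add: x)
  qed
  then have "(\<lambda>(n, m). T n m) summable_on UNIV \<times> UNIV"
    by (rule abs_summable_summable)
  then obtain S where S: "((\<lambda>(n, m). T n m) has_sum S) (UNIV \<times> UNIV)"
    by (auto simp: summable_on_def)
  have 1: "((\<lambda>n. e n * z ^ n * E (c * p ^ n)) has_sum S) UNIV"
    by (rule has_sum_SigmaD[OF S])
      (simp add: T_def has_sum_cmult_right euler_has_sum)
  have S': "((\<lambda>(m, n). T n m) has_sum S) (UNIV \<times> UNIV)"
    using has_sum_swap[THEN iffD1, OF S] by (simp add: case_prod_unfold)
  have 2: "((\<lambda>m. e m * c ^ m * E (z * p ^ m)) has_sum S) UNIV"
    by (rule has_sum_SigmaD[OF S'])
      (simp add: T' has_sum_cmult_right euler_has_sum)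
  from 1 2 show ?thesis
    using has_sum_unique by blast
qed

text \<open>The left-hand series is, up to a constant, that of j_\<alpha>. The symmetry moves the
  lattice point p^(k+1) into the argument of E, where \<open>euler_powi\<close> produces the
  coefficients \<open>gz (k + int m)\<close> of F_k.\<close>

lemma bessel_series_has_sum:
  assumes c: "0 < c" "c < 1"
  shows "((\<lambda>n. e n * (p powi (k + 1)) ^ n * E (c * p ^ n)) has_sum (E p * hahn_exton p c k)) UNIV"
proof (subst euler_double_sum_symmetric)
  have "E (p powi (k + 1) * p ^ m) = E p * gz (k + int m)" for m
  proof -
    have "p powi (k + 1) * p ^ m = p powi (k + int m + 1)"
      using p by (simp add: power_int_add)
    then show ?thesis by (simp add: euler_powi)
  qed
  then show "((\<lambda>m. e m * c ^ m * E (p powi (k + 1) * p ^ m)) has_sum (E p * hahn_exton p c k)) UNIV"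
    using has_sum_cmult_right[OF hahn_exton_has_sum[of c k], of "E p"] by (simp add: mult_ac)
qed (use p c in auto)

section \<open>Orthogonality of the Laurent coefficients\<close>

lemma convolution_has_sum:
  "((\<lambda>k. ez (j - k) * gz (k + m)) has_sum (if j + m = 0 then 1 else 0)) UNIV"
proof -
  define n where "n = nat (j + m)"
  \<comment> \<open>The zero extensions restrict the support to -m \<le> k \<le> j, so the sum is
    the finite convolution of order j + m, or empty.\<close>
  have "((\<lambda>k. ez (j - k) * gz (k + m)) has_sum (\<Sum>k\<in>{-m..j}. ez (j - k) * gz (k + m))) {-m..j}"
    by (rule has_sum_finite) simp
  then have "((\<lambda>k. ez (j - k) * gz (k + m)) has_sum (\<Sum>k\<in>{-m..j}. ez (j - k) * gz (k + m))) UNIV"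
    by (rule has_sum_cong_neutral[THEN iffD1, rotated -1]) (auto simp: zero_extend_def)
  moreover have "(\<Sum>k\<in>{-m..j}. ez (j - k) * gz (k + m)) = (if j + m = 0 then 1 else 0)"
  proof (cases "j + m < 0")
    case False
    have "(\<Sum>k\<in>{-m..j}. ez (j - k) * gz (k + m)) = (\<Sum>i\<le>n. e i * g (n - i))"
      by (rule sum.reindex_bij_witness[of _ "\<lambda>i. j - int i" "\<lambda>k. nat (j - k)"])
        (use False in \<open>auto simp: zero_extend_def n_def nat_diff_distrib intro!: arg_cong[where f = g]\<close>)
    then show ?thesis using False by (auto simp: convolution n_def)
  qed auto
  ultimately show ?thesis by simp
qed


text \<open>Justifies exchanging the summations. The factor \<open>gz (k + d + n)\<close> is bounded
  uniformly; in the variables i = j - k, n, j the rest is a product of three absolutely summable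
  families, the one in j being dominated by a geometric series as c < 1.\<close>

lemma orthogonality_summable:
  assumes c: "0 < c" "c < 1"
  shows "(\<lambda>(k, n, j). ez (j - k) * (c powi j * gz j) * (ez n * c powi n) * gz (k + d + n))
           summable_on UNIV \<times> UNIV \<times> UNIV"
proof -
  define f where "f j = c powi j * gz j" for j
  define u where "u n = \<bar>ez n * c powi n\<bar>" for n
  have "(\<lambda>j. zero_extend (\<lambda>n. c ^ n * g n) j) summable_on UNIV"
  proof -
    have "summable (\<lambda>n. c ^ n * g n)"
    proof (rule summable_comparison_test')
      show "summable (\<lambda>n. c ^ n * inv_qpoch_bound)"
        using c by (intro summable_mult2 summable_geometric) auto
      show "norm (c ^ n * g n) \<le> c ^ n * inv_qpoch_bound" for n
        using inv_qpoch_ext_bounds[of "int n"] c by (auto simp: abs_mult zero_extend_def)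
    qed
    moreover have "c ^ n * g n \<ge> 0" for n
      using c inv_qpoch_pos[of n] by simp
    ultimately have "(\<lambda>n. c ^ n * g n) summable_on UNIV"
      by (rule summable_nonneg_imp_summable_on)
    then show ?thesis by (auto simp: summable_on_def has_sum_zero_extend[of "\<lambda>n. c ^ n * g n"])
  qed
  moreover have "zero_extend (\<lambda>n. c ^ n * g n) = f"
    by (auto simp: zero_extend_def f_def power_int_def)
  ultimately have f: "f summable_on UNIV" by simp
  have "zero_extend (\<lambda>n. \<bar>e n * a ^ n\<bar>) summable_on UNIV" for a
    using summable_nonneg_imp_summable_on[OF summable_abs_euler[of a]]
    by (auto simp: summable_on_def has_sum_zero_extend)
  moreover have "zero_extend (\<lambda>n. \<bar>e n * c ^ n\<bar>) = u" "zero_extend (\<lambda>n. \<bar>e n * 1 ^ n\<bar>) = (\<lambda>i. \<bar>ez i\<bar>)"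
    by (auto simp: zero_extend_def u_def power_int_def)
  ultimately have u: "u summable_on UNIV" and v: "(\<lambda>i. \<bar>ez i\<bar>) summable_on UNIV"
    by metis+
  have f0: "f j \<ge> 0" for j
    using c inv_qpoch_ext_bounds[of j] by (simp add: f_def)
  have u0: "u n \<ge> 0" for n by (simp add: u_def)
  have "(\<lambda>(i, n, j). \<bar>ez i\<bar> * (case (n, j) of (n, j) \<Rightarrow> u n * f j)) summable_on UNIV \<times> UNIV \<times> UNIV"
    using summable_on_Times_nonneg[OF v summable_on_Times_nonneg[OF u f]]
    by (auto simp: u0 f0 case_prod_unfold)
  then have "(\<lambda>(k, n, j). \<bar>ez (j - k)\<bar> * (u n * f j)) summable_on UNIV \<times> UNIV \<times> UNIV"
    by (rule summable_on_reindex_bij_witness[where i = "\<lambda>(k, n, j). (j - k, n, j)" and j = "\<lambda>(k, n, j). (j - k, n, j)", THEN iffD1, rotated -1]) auto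
  then have "(\<lambda>x. (case x of (k, n, j) \<Rightarrow> \<bar>ez (j - k)\<bar> * (u n * f j)) * inv_qpoch_bound) summable_on UNIV \<times> UNIV \<times> UNIV"
    by (rule summable_on_cmult_left)
  then have "(\<lambda>x. norm (case x of (k, n, j) \<Rightarrow>
      ez (j - k) * (c powi j * gz j) * (ez n * c powi n) * gz (k + d + n)))
      summable_on UNIV \<times> UNIV \<times> UNIV"
  proof (rule Infinite_Sum.abs_summable_on_comparison_test')
    fix x :: "int \<times> int \<times> int"
    obtain k n j where x: "x = (k, n, j)" by (cases x)
    have "norm (ez (j - k) * (c powi j * gz j) * (ez n * c powi n) * gz (k + d + n))
      = \<bar>ez (j - k)\<bar> * (u n * f j) * gz (k + d + n)"
      using f0[of j] inv_qpoch_ext_bounds(1)[of "k + d + n"]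
      by (simp add: abs_mult u_def flip: f_def)
    also have "\<dots> \<le> \<bar>ez (j - k)\<bar> * (u n * f j) * inv_qpoch_bound"
      using f0[of j] u0[of n] inv_qpoch_ext_bounds(2) by (intro mult_left_mono) auto
    finally show "norm (case x of (k, n, j) \<Rightarrow>
      ez (j - k) * (c powi j * gz j) * (ez n * c powi n) * gz (k + d + n))
      \<le> (case x of (k, n, j) \<Rightarrow> \<bar>ez (j - k)\<bar> * (u n * f j)) * inv_qpoch_bound"
      by (simp add: x)
  qed
  then show ?thesis by (rule abs_summable_summable)
qed

lemma hahn_exton_has_sum_int:
  "((\<lambda>n. ez n * c powi n * gz (k + n)) has_sum hahn_exton p c k) UNIV"
proof -
  have "zero_extend (\<lambda>n. e n * c ^ n * gz (k + int n)) = (\<lambda>n. ez n * c powi n * gz (k + n))"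
    by (auto simp: zero_extend_def power_int_def)
  then show ?thesis
    using hahn_exton_has_sum[of c k] has_sum_zero_extend[of "\<lambda>n. e n * c ^ n * gz (k + int n)"] by simp
qed

text \<open>The substitution j = k + n moves the powers of c from the e-coefficients to the
  g-coefficients. The result expands c^k F_k as the coefficient of s^(-k) in G(c/s) = (s;
  p)_\<infinity> / (c/s; p)_\<infinity>.\<close>

lemma hahn_exton_has_sum_shifted:
  assumes "c \<noteq> 0"
  shows "((\<lambda>j. ez (j - k) * (c powi j * gz j)) has_sum (c powi k * hahn_exton p c k)) UNIV"
proof -
  have "((\<lambda>n. c powi k * (ez n * c powi n * gz (k + n))) has_sum (c powi k * hahn_exton p c k)) UNIV"
    by (intro has_sum_cmult_right hahn_exton_has_sum_int)
  then show ?thesis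
    by (rule has_sum_reindex_bij_witness[where i = "\<lambda>j. j - k" and j = "\<lambda>n. n + k", THEN iffD1, rotated -1])
      (use assms in \<open>auto simp: power_int_add mult_ac add.commute\<close>)
qed

text \<open>Both sides are evaluations of one absolutely convergent triple series: summing over \<open>k\<close>
  last gives the left-hand side, summing over \<open>k\<close> first collapses it by the convolution
  identity \<open>(s; p)\<^sub>\<infinity> \<cdot> 1 / (s; p)\<^sub>\<infinity> = 1\<close>.\<close>

lemma hahn_exton_orthogonality:
  assumes c: "0 < c" "c < 1"
  shows "((\<lambda>k. c powi k * hahn_exton p c k * hahn_exton p c (k + d)) has_sum
           (if d = 0 then 1 else 0)) UNIV"
proof -
  define T where "T k n j = ez (j - k) * (c powi j * gz j) * (ez n * c powi n) * gz (k + d + n)" for k n j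
  obtain S where S: "((\<lambda>(k, n, j). T k n j) has_sum S) (UNIV \<times> UNIV \<times> UNIV)"
    using orthogonality_summable[OF c, of d] by (auto simp: summable_on_def T_def)
  have inner: "((\<lambda>(n, j). T k n j) has_sum (c powi k * hahn_exton p c k * hahn_exton p c (k + d))) (UNIV \<times> UNIV)" for k
  proof (rule has_sum_SigmaI)
    fix n
    show "((\<lambda>j. case (n, j) of (n, j) \<Rightarrow> T k n j) has_sum
        (c powi k * hahn_exton p c k * (ez n * c powi n * gz (k + d + n)))) UNIV"
      using has_sum_cmult_left[OF hahn_exton_has_sum_shifted[of c k], of "ez n * c powi n * gz (k + d + n)"] c
      by (simp add: T_def mult_ac)
  next
    show "((\<lambda>n. c powi k * hahn_exton p c k * (ez n * c powi n * gz (k + d + n))) has_sum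
        (c powi k * hahn_exton p c k * hahn_exton p c (k + d))) UNIV"
      by (intro has_sum_cmult_right hahn_exton_has_sum_int)
    show "(\<lambda>(n, j). T k n j) summable_on UNIV \<times> UNIV"
      using summable_on_SigmaD1[of "\<lambda>k (n, j). T k n j" UNIV "\<lambda>_. UNIV \<times> UNIV" k] S
      by (auto simp: summable_on_def)
  qed
  have 1: "((\<lambda>k. c powi k * hahn_exton p c k * hahn_exton p c (k + d)) has_sum S) UNIV"
    by (rule has_sum_SigmaD[OF S]) (use inner in auto)
  have S': "((\<lambda>((n, j), k). T k n j) has_sum S) ((UNIV \<times> UNIV) \<times> UNIV)"
    using has_sum_swap[THEN iffD1, OF S] by (simp add: case_prod_unfold)
  \<comment> \<open>What summation over k leaves: a Kronecker symbol that confines the remaining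
    double sum to the diagonal j = -d - n.\<close>
  define R where "R = (\<lambda>(n, j). c powi j * gz j * (ez n * c powi n) * (if j + (d + n) = 0 then 1 else 0))"
  have "((\<lambda>k. T k n j) has_sum R (n, j)) UNIV" for n j
    using has_sum_cmult_right[OF convolution_has_sum[of j "d + n"], of "c powi j * gz j * (ez n * c powi n)"]
    by (simp add: T_def R_def mult_ac add_ac)
  then have "(R has_sum S) (UNIV \<times> UNIV)"
    by (intro has_sum_SigmaD[OF S']) auto
  moreover have "R x = 0" if "x \<notin> range (\<lambda>n. (- d - n, n))" for x
  proof (cases x)
    case (Pair n j)
    have "j + (d + n) \<noteq> 0"
      using that Pair by (auto simp: image_iff)
    then show ?thesis using Pair by (simp add: R_def)
  qed
  ultimately have "(R has_sum S) (range (\<lambda>n. (- d - n, n)))"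
    by (elim has_sum_cong_neutral[THEN iffD1, rotated -1]) auto
  then have "((R \<circ> (\<lambda>n. (- d - n, n))) has_sum S) UNIV"
    by (subst (asm) has_sum_reindex) (auto intro: injI)
  \<comment> \<open>The bound variable now stands for j. On the diagonal the powers of c combine to
    c^(-d), and a second convolution with total index -d remains.\<close>
  moreover have "R \<circ> (\<lambda>n. (- d - n, n)) = (\<lambda>n. c powi (- d) * (ez (- d - n) * gz (n + 0)))"
    using c by (auto simp: R_def fun_eq_iff power_int_add[symmetric] mult_ac simp flip: power_int_add)
  ultimately have 2: "((\<lambda>n. c powi (- d) * (ez (- d - n) * gz n)) has_sum S) UNIV"
    by simp
  have "((\<lambda>n. c powi (- d) * (ez (- d - n) * gz (n + 0))) has_sum
     c powi (- d) * (if - d + 0 = 0 then 1 else 0)) UNIV"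
    by (intro has_sum_cmult_right convolution_has_sum)
  with 2 have "S = c powi (- d) * (if - d + 0 = 0 then 1 else 0)"
    using has_sum_unique by fastforce
  with 1 show ?thesis by (cases "d = 0") auto
qed

text \<open>In the Jackson sum over n the points x and y enter as index shifts r and s. Setting k =
  n + r and d = s - r gives the factor c^(-r).\<close>

lemma hahn_exton_shifted_orthogonality:
  assumes c: "0 < c" "c < 1"
  shows "((\<lambda>n. c powi n * hahn_exton p c (n + r) * hahn_exton p c (n + s)) has_sum
           (if r = s then c powi (- r) else 0)) UNIV"
proof -
  have "((\<lambda>k. c powi (- r) * (c powi k * hahn_exton p c k * hahn_exton p c (k + (s - r)))) has_sum
      c powi (- r) * (if s - r = 0 then 1 else 0)) UNIV"
    by (intro has_sum_cmult_right hahn_exton_orthogonality c)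
  then show ?thesis
    by (rule has_sum_reindex_bij_witness[where i = "\<lambda>n. n + r" and j = "\<lambda>k. k - r", THEN iffD1, rotated -1])
      (use c in \<open>auto simp: power_int_diff power_int_minus field_simps\<close>)
qed

end

section \<open>Translation of j_\<alpha> into Hahn-Exton functions\<close>

lemma powr_powi_swap:
  fixes x s :: real
  assumes "x > 0"
  shows "(x powr s) powi k = (x powi k) powr s"
  using assms by (simp add: powr_powr mult.commute flip: powr_real_of_int')

text \<open>Euler's coefficient is (-1)^n q^(n(n-1)) / (p; p)_n with p = q^2; the additional p^n
  turns its exponent into the n(n+1) of the Bessel series.\<close>

lemma euler_coeff_closed_form:
  assumes "0 < q" "q < 1"
  shows "euler_coeff (q\<^sup>2) n * (q\<^sup>2) ^ n = (- 1) ^ n * q ^ (n * (n + 1)) * inv_qpoch (q\<^sup>2) n"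
proof (induction n)
  case (Suc n)
  have "(q\<^sup>2) ^ n * q\<^sup>2 * q ^ (n * (n + 1)) = q ^ (Suc n * (Suc n + 1))"
    by (simp add: algebra_simps power2_eq_square flip: power_mult power_add power_Suc)
  have "euler_coeff (q\<^sup>2) (Suc n) * (q\<^sup>2) ^ Suc n
      = - ((q\<^sup>2) ^ n * q\<^sup>2 / (1 - (q\<^sup>2) ^ Suc n)) * (euler_coeff (q\<^sup>2) n * (q\<^sup>2) ^ n)"
    by simp
  also have "\<dots> = (- 1) ^ Suc n * ((q\<^sup>2) ^ n * q\<^sup>2 * q ^ (n * (n + 1))) * inv_qpoch (q\<^sup>2) (Suc n)"
    unfolding Suc by simp
  also have "(q\<^sup>2) ^ n * q\<^sup>2 * q ^ (n * (n + 1)) = q ^ (Suc n * (Suc n + 1))"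
    by fact
  finally show ?case .
qed simp

context
  fixes q p :: real
  assumes q: "0 < q" "q < 1"
  defines "p \<equiv> q\<^sup>2"
begin

interpretation q_base p
  by unfold_locales (use q in \<open>auto simp: p_def power_less_one_iff\<close>)

lemma q_Gamma_eq_euler:
  assumes "s > 0"
  shows "q_Gamma p s = euler_sum p p / euler_sum p (p powr s) * (1 - p) powr (1 - s)"
proof -
  have "p powr s < 1"
    using p assms by (simp add: powr01_less_one)
  then show ?thesis
    using p by (simp add: q_Gamma_def qpoch_inf_eq_euler)
qed

lemma q_bessel_eq_hahn_exton:
  assumes \<alpha>: "\<alpha> > - 1" and x: "((1 - q) * x)\<^sup>2 = p powi k"
  defines "c \<equiv> p powr (\<alpha> + 1)"
  shows "q_bessel q \<alpha> x = euler_sum p p / euler_sum p c * hahn_exton p c k"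
proof -
  have c: "0 < c" "c < 1"
    using p \<alpha> by (auto simp: c_def powr01_less_one)
  have pos: "euler_sum p p > 0" "euler_sum p (c * p ^ n) > 0" "euler_sum p (p ^ Suc n) > 0" for n
  proof -
    have "c * p ^ n \<le> c * 1" using p c by (intro mult_left_mono power_le_one) auto
    then have "c * p ^ n < 1" using c by linarith
    then show "euler_sum p (c * p ^ n) > 0" using p c by (intro euler_pos) auto
    show "euler_sum p p > 0" "euler_sum p (p ^ Suc n) > 0"
      using p pow_Suc_less[of n] by (auto intro!: euler_pos simp del: power_Suc)
  qed
  have term_eq: "(- 1) ^ n * (q_Gamma p (\<alpha> + 1) * q ^ (n * (n + 1))
           / (q_Gamma p (\<alpha> + real n + 1) * q_Gamma p (real n + 1))) * (x / (1 + q)) ^ (2 * n)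
      = euler_coeff p n * (p powi (k + 1)) ^ n * euler_sum p (c * p ^ n) / euler_sum p c" for n
  proof -
    have G1: "q_Gamma p (\<alpha> + 1) = euler_sum p p / euler_sum p c * (1 - p) powr (- \<alpha>)"
      using \<alpha> by (simp add: q_Gamma_eq_euler c_def)
    have "p powr (\<alpha> + real n + 1) = p powr (\<alpha> + 1 + real n)"
      by (simp add: add_ac)
    also have "\<dots> = c * p ^ n"
      using p by (simp add: c_def powr_add powr_realpow)
    finally have "p powr (\<alpha> + real n + 1) = c * p ^ n" .
    moreover have "(1 - p) powr (1 - (\<alpha> + real n + 1)) = (1 - p) powr (- \<alpha>) / (1 - p) ^ n"
      using p powr_diff[of "1 - p" "- \<alpha>" "real n"] by (simp add: powr_realpow algebra_simps)
    ultimately have G2: "q_Gamma p (\<alpha> + real n + 1)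
        = euler_sum p p / euler_sum p (c * p ^ n) * ((1 - p) powr (- \<alpha>) / (1 - p) ^ n)"
      using \<alpha> by (simp add: q_Gamma_eq_euler)
    have "p powr (real n + 1) = p ^ Suc n"
      using p powr_realpow[of p "Suc n"] by (simp add: add.commute)
    moreover have "(1 - p) powr (1 - (real n + 1)) = 1 / (1 - p) ^ n"
      using p by (simp add: powr_minus_divide powr_realpow)
    ultimately have "q_Gamma p (real n + 1) = euler_sum p p / euler_sum p (p ^ Suc n) * (1 / (1 - p) ^ n)"
      by (simp add: q_Gamma_eq_euler del: power_Suc)
    then have G3: "q_Gamma p (real n + 1) = 1 / (inv_qpoch p n * (1 - p) ^ n)"
      using pos(1) by (simp add: euler_pow_Suc del: power_Suc)
    \<comment> \<open>The q-Gamma values at \<alpha>+n+1 and n+1 contribute one factor (1-p)^n each.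
      Together they turn the argument x/(1+q) into (1-q) x, whose square is the lattice point
      p^k.\<close>
    have "(1 - p) * (x / (1 + q)) = (1 - q) * x"
      using q by (simp add: p_def power2_eq_square field_simps)
    then have X: "((1 - p) ^ n)\<^sup>2 * (x / (1 + q)) ^ (2 * n) = (p powi k) ^ n"
      by (metis power_mult power_mult_distrib x mult.commute)
    have "(- 1) ^ n * (q_Gamma p (\<alpha> + 1) * q ^ (n * (n + 1))
           / (q_Gamma p (\<alpha> + real n + 1) * q_Gamma p (real n + 1))) * (x / (1 + q)) ^ (2 * n)
        = ((- 1) ^ n * q ^ (n * (n + 1)) * inv_qpoch p n) * (((1 - p) ^ n)\<^sup>2 * (x / (1 + q)) ^ (2 * n))
          * euler_sum p (c * p ^ n) / euler_sum p c"
      unfolding G1 G2 G3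
      using p pos(1) pos(2)[of n] pos(2)[of 0] inv_qpoch_pos[of n]
      by (simp add: power2_eq_square mult_ac)
    also have "(- 1) ^ n * q ^ (n * (n + 1)) * inv_qpoch p n = euler_coeff p n * p ^ n"
      using euler_coeff_closed_form[OF q] by (simp add: p_def)
    also note X
    \<comment> \<open>The additional p^n shifts the lattice exponent from k to k + 1, as
      \<open>bessel_series_has_sum\<close> requires.\<close>
    also have "euler_coeff p n * p ^ n * (p powi k) ^ n = euler_coeff p n * (p powi (k + 1)) ^ n"
      using p by (simp add: power_int_add power_mult_distrib)
    finally show ?thesis .
  qed
  have "((\<lambda>n. euler_coeff p n * (p powi (k + 1)) ^ n * euler_sum p (c * p ^ n) / euler_sum p c)
      has_sum (euler_sum p p * hahn_exton p c k / euler_sum p c)) UNIV"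
    by (intro has_sum_divide_const bessel_series_has_sum c)
  then show ?thesis
    unfolding q_bessel_def p_def[symmetric] term_eq
    using has_sum_imp_sums sums_unique by fastforce
qed

end

section \<open>The Dunkl kernel under the Jackson integral\<close>

lemma kernel_even_part:
  fixes u v u' v' l x y b :: real
  shows "(of_real u + \<i> * of_real (l * x) / of_real b * of_real v)
           * cnj (of_real u' + \<i> * of_real (l * y) / of_real b * of_real v')
       + (of_real u + \<i> * of_real (- l * x) / of_real b * of_real v)
           * cnj (of_real u' + \<i> * of_real (- l * y) / of_real b * of_real v')
       = of_real (2 * (u * u' + l\<^sup>2 * x * y * v * v' / b\<^sup>2))"
  \<comment> \<open>The mixed products are odd in l and cancel; conjugation gives the product of the
    odd parts the sign +1.\<close>
  by (simp add: complex_eq_iff power2_eq_square field_simps)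

theorem proposition7:
  fixes q \<alpha> x y :: real
  assumes q: "0 < q" "q < 1"
    and q_lattice: "\<exists>m::int. ln (1 - q) / ln q = 2 * real_of_int m"
    and alpha: "\<alpha> \<ge> - 1 / 2"
    and xy: "x \<in> R_q q" "y \<in> R_q q"
  shows "jackson_integrable q
           (\<lambda>l. q_dunkl_kernel q \<alpha> l x * cnj (q_dunkl_kernel q \<alpha> l y)
                * of_real (\<bar>l\<bar> powr (2 * \<alpha> + 1)))
       \<and> jackson_integral q
           (\<lambda>l. q_dunkl_kernel q \<alpha> l x * cnj (q_dunkl_kernel q \<alpha> l y)
                * of_real (\<bar>l\<bar> powr (2 * \<alpha> + 1)))
         = of_real (4 * (1 + q) powr (2 * \<alpha>) * (q_Gamma (q^2) (\<alpha> + 1))^2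
                    * (if x = y then 1 else 0)
                    / ((1 - q) * \<bar>x * y\<bar> powr (\<alpha> + 1)))"
proof -
  define p where "p = q\<^sup>2"
  interpret q_base p
    by unfold_locales (use q in \<open>auto simp: p_def power_less_one_iff\<close>)
  obtain m :: int where "ln (1 - q) / ln q = 2 * real_of_int m"
    using q_lattice by blast
  then have "ln (1 - q) = real_of_int (2 * m) * ln q"
    using q by (simp add: field_simps)
  then have "1 - q = q powr real_of_int (2 * m)"
    using q exp_ln[of "1 - q"] by (simp add: powr_def)
  \<comment> \<open>With 1 - q = q^M, the factor 1 - q in the Bessel argument is an index shift by
    M.\<close>
  then obtain M :: int where M: "1 - q = q powi M"
    using q powr_real_of_int'[of q "2 * m"] by (metis less_eq_real_def less_irrefl)
  obtain a where a: "x = q powi a \<or> x = - (q powi a)"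
    using xy by (auto simp: R_q_def)
  obtain b where b: "y = q powi b \<or> y = - (q powi b)"
    using xy by (auto simp: R_q_def)
  have p_powi: "p powi k = (q powi k)\<^sup>2" for k
    using power_int_mult[of q 2 k] power_int_mult[of q k 2] by (simp add: p_def mult.commute)
  \<comment> \<open>Squaring removes the signs of l and z, so one index serves all four sign
    choices.\<close>
  have arg: "((1 - q) * (l * z))\<^sup>2 = p powi (n + (k + M))"
    if "l = q powi n \<or> l = - (q powi n)" "z = q powi k \<or> z = - (q powi k)" for l z n k
    using that q by (auto simp: M p_powi power_int_add power_mult_distrib)
  define c where "c = p powr (\<alpha> + 1)"
  define c1 where "c1 = p powr (\<alpha> + 1 + 1)"
  define br where "br = q_bracket q (2 * \<alpha> + 2)"
  have c: "0 < c" "c < 1" and c1: "0 < c1" "c1 < 1"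
    using p alpha by (auto simp: c_def c1_def powr01_less_one)
  have c1_eq: "c1 = c * p"
    using p by (simp add: c_def c1_def powr_add power2_eq_square)
  have br: "br = (1 - c) / (1 - q)"
    using q by (simp add: br_def q_bracket_def c_def p_def powr_powr algebra_simps flip: powr_numeral)
  define D where "D = euler_sum p p / euler_sum p c"
  \<comment> \<open>Since c = q^(2\<alpha>+2), the factor 1 - c is the numerator of [2\<alpha>+2]_q.
    Dividing by that bracket leaves 1 - q, so both Bessel parts carry the same constant D.\<close>
  have D1: "euler_sum p p / euler_sum p c1 = D * (1 - c)"
    using euler_rec[of c] c euler_pos[OF c] by (simp add: D_def c1_eq mult.commute)
  define h where "h = hahn_exton p c"
  define h1 where "h1 = hahn_exton p c1"
  have bessel: "q_bessel q \<alpha> (l * z) = D * h (n + (k + M))"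
    "q_bessel q (\<alpha> + 1) (l * z) = D * (1 - c) * h1 (n + (k + M))"
    if "l = q powi n \<or> l = - (q powi n)" "z = q powi k \<or> z = - (q powi k)" for l z n k
    using q_bessel_eq_hahn_exton[OF q, of \<alpha>, folded p_def, OF _ arg[OF that], folded c_def]
      q_bessel_eq_hahn_exton[OF q, of "\<alpha> + 1", folded p_def, OF _ arg[OF that], folded c1_def] alpha
    unfolding D1 by (simp_all add: h_def h1_def D_def)
  define f where "f = (\<lambda>l. q_dunkl_kernel q \<alpha> l x * cnj (q_dunkl_kernel q \<alpha> l y)
                * of_real (\<bar>l\<bar> powr (2 * \<alpha> + 1)))"
  \<comment> \<open>The even and the odd parts, arranged as orthogonality families with parameters c
    (for \<alpha>) and c1 (for \<alpha>+1).\<close>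
  define t where "t n = 2 * D\<^sup>2 * (c powi n * h (n + (a + M)) * h (n + (b + M)))
      + 2 * D\<^sup>2 * (1 - q)\<^sup>2 * x * y * (c1 powi n * h1 (n + (a + M)) * h1 (n + (b + M)))" for n
  have summand: "jackson_summand q f n = of_real (t n)" for n
  proof -
    define L where "L = q powi n"
    have L: "L > 0" using q by (simp add: L_def)
    \<comment> \<open>The Jackson weight q^n and |l|^(2\<alpha>+1) combine to the orthogonality
      weight c^n; the l^2 from the odd parts raises it to c1^n.\<close>
    have weight: "L * L powr (2 * \<alpha> + 1) = c powi n"
    proof -
      have "L * L powr (2 * \<alpha> + 1) = L powr (2 * (\<alpha> + 1))"
        using L powr_add[of L 1 "2 * \<alpha> + 1"] by (simp add: algebra_simps)
      also have "\<dots> = (p powi n) powr (\<alpha> + 1)"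
        using L by (simp add: p_powi powr_powr flip: L_def powr_numeral)
      finally show ?thesis using p by (simp add: c_def powr_powi_swap)
    qed
    have weight1: "c1 powi n = c powi n * L\<^sup>2"
      by (simp add: c1_eq power_int_mult_distrib p_powi L_def)
    have kernel: "q_dunkl_kernel q \<alpha> l z = of_real (D * h (n + (k + M)))
        + \<i> * of_real (l * z) / of_real br * of_real (D * (1 - c) * h1 (n + (k + M)))"
      if "l = L \<or> l = - L" "z = q powi k \<or> z = - (q powi k)" for l z k
      unfolding q_dunkl_kernel_def br_def[symmetric]
      by (simp only: bessel[OF that[unfolded L_def]])
    have f_eq: "f l = q_dunkl_kernel q \<alpha> l x * cnj (q_dunkl_kernel q \<alpha> l y) * of_real (L powr (2 * \<alpha> + 1))"
      if "l = L \<or> l = - L" for l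
      using that L by (auto simp: f_def)
    have "f L + f (- L) = (q_dunkl_kernel q \<alpha> L x * cnj (q_dunkl_kernel q \<alpha> L y)
        + q_dunkl_kernel q \<alpha> (- L) x * cnj (q_dunkl_kernel q \<alpha> (- L) y)) * of_real (L powr (2 * \<alpha> + 1))"
      by (simp only: f_eq simp_thms distrib_right)
    also have "\<dots> = of_real (L powr (2 * \<alpha> + 1)
        * (2 * (D * h (n + (a + M)) * (D * h (n + (b + M)))
            + L\<^sup>2 * x * y * (D * (1 - c) * h1 (n + (a + M))) * (D * (1 - c) * h1 (n + (b + M))) / br\<^sup>2)))"
      unfolding kernel[OF disjI1[OF refl] a] kernel[OF disjI1[OF refl] b]
        kernel[OF disjI2[OF refl] a] kernel[OF disjI2[OF refl] b] kernel_even_part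
      by (simp only: of_real_mult mult.commute)
    finally have "f L + f (- L) = of_real (L powr (2 * \<alpha> + 1)
        * (2 * (D * h (n + (a + M)) * (D * h (n + (b + M)))
            + L\<^sup>2 * x * y * (D * (1 - c) * h1 (n + (a + M))) * (D * (1 - c) * h1 (n + (b + M))) / br\<^sup>2)))" .
    then have "jackson_summand q f n = of_real (L * (L powr (2 * \<alpha> + 1)
        * (2 * (D * h (n + (a + M)) * (D * h (n + (b + M)))
            + L\<^sup>2 * x * y * (D * (1 - c) * h1 (n + (a + M))) * (D * (1 - c) * h1 (n + (b + M))) / br\<^sup>2))))"
      by (simp add: jackson_summand_def L_def)
    also have "L * (L powr (2 * \<alpha> + 1)
        * (2 * (D * h (n + (a + M)) * (D * h (n + (b + M)))
            + L\<^sup>2 * x * y * (D * (1 - c) * h1 (n + (a + M))) * (D * (1 - c) * h1 (n + (b + M))) / br\<^sup>2))) = t n"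
    proof -
      have br': "1 - c = (1 - q) * br" "br \<noteq> 0"
        using c q by (auto simp: br)
      have eq: "L\<^sup>2 * x * y * (D * (1 - c) * h1 (n + (a + M))) * (D * (1 - c) * h1 (n + (b + M))) / br\<^sup>2
         = L\<^sup>2 * x * y * D\<^sup>2 * h1 (n + (a + M)) * h1 (n + (b + M)) * (1 - q)\<^sup>2"
        unfolding br'(1) using br'(2) by (simp add: power2_eq_square)
      show ?thesis
        unfolding eq
        unfolding t_def weight1 mult.assoc[symmetric] weight
        by (simp add: algebra_simps power2_eq_square)
    qed
    finally show ?thesis .
  qed
  define S where "S = 4 * D\<^sup>2 * c powi (- (a + M)) * (if x = y then 1 else 0)"
  have "(t has_sum 2 * D\<^sup>2 * (if a + M = b + M then c powi (- (a + M)) else 0)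
      + 2 * D\<^sup>2 * (1 - q)\<^sup>2 * x * y * (if a + M = b + M then c1 powi (- (a + M)) else 0)) UNIV"
    unfolding t_def h_def h1_def
    by (intro has_sum_add has_sum_cmult_right hahn_exton_shifted_orthogonality c c1)
  moreover have "2 * D\<^sup>2 * (if a + M = b + M then c powi (- (a + M)) else 0)
      + 2 * D\<^sup>2 * (1 - q)\<^sup>2 * x * y * (if a + M = b + M then c1 powi (- (a + M)) else 0) = S"
  proof (cases "a = b")
    case False
    then have "q powi a \<noteq> q powi b"
      using q by (simp add: powr_inj flip: powr_real_of_int')
    moreover have "q powi a > 0" "q powi b > 0"
      using q by auto
    ultimately have "x \<noteq> y"
      using a b by auto
    then show ?thesis using False by (simp add: S_def)
  next
    case True
    have pos: "q powi a > 0" "q powi M > 0" using q by auto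
    \<comment> \<open>Here y = x or y = -x. As c1 = c p and p^(a+M) = q^(2a) (1-q)^2, the prefactor
      (1-q)^2 x y makes the second sum plus or minus the first: they double or cancel.\<close>
    have "c1 powi (- (a + M)) = c powi (- (a + M)) / ((q powi a)\<^sup>2 * (1 - q)\<^sup>2)"
      using q by (simp add: c1_eq power_int_mult_distrib power_int_minus power_int_diff p_powi M field_simps)
    then have c1_powi: "(1 - q)\<^sup>2 * (q powi a)\<^sup>2 * c1 powi (- (a + M)) = c powi (- (a + M))"
      using pos q by simp
    have xy_eq: "x * y = (if x = y then 1 else - 1) * (q powi a)\<^sup>2"
      using a b True pos by (auto simp: power2_eq_square)
    have "(1 - q)\<^sup>2 * x * y * c1 powi (- (a + M)) = (x * y) * ((1 - q)\<^sup>2 * c1 powi (- (a + M)))"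
      by (simp only: mult_ac)
    also have "\<dots> = (if x = y then 1 else - 1) * ((1 - q)\<^sup>2 * (q powi a)\<^sup>2 * c1 powi (- (a + M)))"
      by (subst xy_eq) (simp only: mult_ac)
    also note c1_powi
    finally have "(1 - q)\<^sup>2 * x * y * c1 powi (- (a + M)) = (if x = y then 1 else - 1) * c powi (- (a + M))" .
    then have "2 * D\<^sup>2 * c powi (- (a + M)) + 2 * D\<^sup>2 * ((1 - q)\<^sup>2 * x * y * c1 powi (- (a + M))) = S"
      by (simp add: S_def)
    then show ?thesis using True by (simp add: mult.assoc)
  qed
  ultimately have "(t has_sum S) UNIV" by simp
  then have "((\<lambda>n. of_real (t n) :: complex) has_sum of_real S) UNIV"
    by (simp add: has_sum_of_real_iff)
  then have sum: "(jackson_summand q f has_sum of_real S) UNIV"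
    by (simp add: summand[abs_def])
  have total: "(1 - q) * S = 4 * (1 + q) powr (2 * \<alpha>) * (q_Gamma p (\<alpha> + 1))\<^sup>2
      * (if x = y then 1 else 0) / ((1 - q) * \<bar>x * y\<bar> powr (\<alpha> + 1))"
  proof (cases "x = y")
    case True
    have pos: "q powi a > 0" "1 - q > 0" "1 + q > 0" using q by auto
    have G: "q_Gamma p (\<alpha> + 1) = D * (1 - p) powr (- \<alpha>)"
      using q_Gamma_eq_euler[OF q, of "\<alpha> + 1"] alpha by (simp add: D_def c_def p_def)
    \<comment> \<open>Hence D^2 is the squared q-Gamma value times (1-q)^(2\<alpha>)
      (1+q)^(2\<alpha>). Against c^(-M) = (1-q)^(-2\<alpha>-2) and the prefactor 1 - q of the
      integral, only 1/(1-q) remains of the powers of 1 - q.\<close>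
    have "1 - p = (1 - q) * (1 + q)"
      by (simp add: p_def power2_eq_square algebra_simps)
    then have G2: "(q_Gamma p (\<alpha> + 1))\<^sup>2 = D\<^sup>2 * ((1 - q) powr (- 2 * \<alpha>) * (1 + q) powr (- 2 * \<alpha>))"
      using pos by (simp add: G power_mult_distrib powr_mult powr_powr mult.commute flip: powr_numeral)
    have "c powi a = \<bar>x * y\<bar> powr (\<alpha> + 1)"
      using a True p by (auto simp: c_def powr_powi_swap p_powi power2_eq_square abs_mult)
    moreover have "c powi M = (1 - q) powr (2 * \<alpha>) * (1 - q)\<^sup>2"
    proof -
      have "c powi M = ((1 - q)\<^sup>2) powr (\<alpha> + 1)"
        using p by (simp add: c_def powr_powi_swap p_powi M)
      also have "\<dots> = (1 - q) powr (2 * \<alpha> + 2)"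
        using pos by (simp add: powr_powr algebra_simps flip: powr_numeral)
      finally show ?thesis using pos by (simp add: powr_add)
    qed
    ultimately have c_powi: "c powi (- (a + M)) = 1 / (\<bar>x * y\<bar> powr (\<alpha> + 1) * ((1 - q) powr (2 * \<alpha>) * (1 - q)\<^sup>2))"
      using c by (simp add: power_int_minus power_int_diff field_simps)
    \<comment> \<open>The final cancellation with r = 1 - q and the real powers as independent
      positive variables, so that it is purely rational.\<close>
    have "r * (4 * D\<^sup>2 * (1 / (X * (u * r\<^sup>2))) * 1)
        = 4 * v * (D\<^sup>2 * (inverse u * inverse v)) * 1 / (r * X)"
      if "r > 0" "u > 0" "v > 0" "X > 0" for r u v X
      using that by (simp add: power2_eq_square field_simps)
    from this[of "1 - q" "(1 - q) powr (2 * \<alpha>)" "(1 + q) powr (2 * \<alpha>)" "\<bar>x * y\<bar> powr (\<alpha> + 1)"]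
    show ?thesis
      unfolding S_def G2 c_powi using True q pos a by (auto simp: powr_minus)
  qed (simp add: S_def)
  show ?thesis
    unfolding f_def[symmetric] p_def[symmetric] total[symmetric] jackson_integrable_def jackson_integral_def
    using sum infsumI[OF sum] by (auto simp: summable_on_def)
qed

end
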